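(* Let $X$ be an alphabet, let $\mathcal{D}=(D,d_0,\Delta,\theta)$ be a crisp-deterministic weighted automaton over $\mathbb{R}$ and $X$, let $V$ be a vector space over $\mathbb{R}$, and let $S\subseteq V$ be a set of vectors which has the same cardinality as $D$. Then there exists a weighted automaton $\mathcal{A}=(S,\sigma,\delta,\Theta)$ over the vector space $V$ (with the same alphabet $X$), having $S$ as its set of vector states, which is language-equivalent to $\mathcal{D}$, i.e. $[\![\mathcal{A}]\!](u)=[\![\mathcal{D}]\!](u)$ for every $u\in X^*$.
   Context: $X^*$ denotes the set of all words over the alphabet $X$, with empty word $\varepsilon$. A crisp-deterministic weighted automaton over $\mathbb{R}$ and $X$ is a tuple $\mathcal{D}=(D,d_0,\Delta,\theta)$, where $D$ is a non-empty (possibly infinite) set of states, $d_0\in D$ is the initial state, $\Delta:D\times X\to D$ is the transition function, and $\theta:D\to\mathbb{R}$ is the terminal weights function. $\Delta$ extends to $\Delta^*:D\times X^*\to D$ by $\Delta^*(a,\varepsilon)=a$ and $\Delta^*(a,ux)=\Delta(\Delta^*(a,u),x)$ for $a\in D$, $u\in X^*$, $x\in X$. The behavior of $\mathcal{D}$ is the function $[\![\mathcal{D}]\!]:X^*\to\mathbb{R}$, $[\![\mathcal{D}]\!](u)=\theta(\Delta^*(d_0,u))$. A weighted automaton over a real vector space $V$ is a tuple $\mathcal{A}=(S,\sigma,\delta,\Theta)$, where $S\subseteq V$ is a non-empty (possibly infinite) set, called the set of vector states, $\sigma\in S$ is the initial vector state, $\delta:S\times X\to S$ is the transition function, and $\Theta:S\to\mathbb{R}$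 is the terminal weights function (no linearity is required). $\delta$ extends to $\delta^*:S\times X^*\to S$ by $\delta^*(\alpha,\varepsilon)=\alpha$ and $\delta^*(\alpha,ux)=\delta(\delta^*(\alpha,u),x)$. The behavior of $\mathcal{A}$ is the function $[\![\mathcal{A}]\!]:X^*\to\mathbb{R}$, $[\![\mathcal{A}]\!](u)=\Theta(\delta^*(\sigma,u))$. *)

theory Defs
  imports Complex_Main "HOL-Library.Equipollence"
begin

text \<open>
  Alphabets are arbitrary sets \<open>X :: 'x set\<close>, and the words over \<open>X\<close> are the elements of
  \<open>lists X\<close>. Transition and terminal weight functions are total HOL functions of which only
  the restrictions to \<open>states \<times> X\<close> and to the states are relevant.
\<close>

record ('d, 'x) crisp_automaton =
  states :: "'d set"
  init :: 'd
  trans :: "'d \<Rightarrow> 'x \<Rightarrow> 'd"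
  weight :: "'d \<Rightarrow> real"

definition crisp_det_weighted_automaton ::
  "'x set \<Rightarrow> ('d, 'x) crisp_automaton \<Rightarrow> bool" where
  "crisp_det_weighted_automaton X \<D> \<longleftrightarrow>
     states \<D> \<noteq> {} \<and> init \<D> \<in> states \<D> \<and>
     (\<forall>a\<in>states \<D>. \<forall>x\<in>X. trans \<D> a x \<in> states \<D>)"

definition trans_ext :: "('d, 'x) crisp_automaton \<Rightarrow> 'd \<Rightarrow> 'x list \<Rightarrow> 'd" where
  "trans_ext \<D> a u = foldl (trans \<D>) a u"

lemma trans_ext_Nil: "trans_ext \<D> a [] = a"
  and trans_ext_snoc: "trans_ext \<D> a (u @ [x]) = trans \<D> (trans_ext \<D> a u) x"
  by (simp_all add: trans_ext_def)

definition behavior :: "('d, 'x) crisp_automaton \<Rightarrow> 'x list \<Rightarrow> real" where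
  "behavior \<D> u = weight \<D> (trans_ext \<D> (init \<D>) u)"

text \<open>
  The vector space \<open>V\<close> is the type \<open>'v\<close> of class \<^class>\<open>real_vector\<close>, so that a set of
  vectors is a term of type \<open>'v set\<close>. Neither the transition function nor the terminal
  weight function is required to be linear.
\<close>

record ('v, 'x) vector_automaton =
  vstates :: "'v set"
  vinit :: 'v
  vtrans :: "'v \<Rightarrow> 'x \<Rightarrow> 'v"
  vweight :: "'v \<Rightarrow> real"

definition weighted_automaton_over ::
  "'x set \<Rightarrow> ('v::real_vector, 'x) vector_automaton \<Rightarrow> bool" where
  "weighted_automaton_over X \<A> \<longleftrightarrow>
     vstates \<A> \<noteq> {} \<and> vinit \<A> \<in> vstates \<A> \<and>
     (\<forall>\<alpha>\<in>vstates \<A>. \<forall>x\<in>X. vtrans \<A> \<alpha> x \<in> vstates \<A>)"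

definition vtrans_ext ::
  "('v::real_vector, 'x) vector_automaton \<Rightarrow> 'v \<Rightarrow> 'x list \<Rightarrow> 'v" where
  "vtrans_ext \<A> \<alpha> u = foldl (vtrans \<A>) \<alpha> u"

lemma vtrans_ext_Nil: "vtrans_ext \<A> \<alpha> [] = \<alpha>"
  and vtrans_ext_snoc: "vtrans_ext \<A> \<alpha> (u @ [x]) = vtrans \<A> (vtrans_ext \<A> \<alpha> u) x"
  by (simp_all add: vtrans_ext_def)

definition vbehavior :: "('v::real_vector, 'x) vector_automaton \<Rightarrow> 'x list \<Rightarrow> real" where
  "vbehavior \<A> u = vweight \<A> (vtrans_ext \<A> (vinit \<A>) u)"

end

theory Submission
  imports Defs
begin

text \<open>Transport of structure: a bijection \<open>f\<close> from \<open>S\<close> onto the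
  states of \<open>\<D>\<close>, with inverse \<open>g\<close>, carries the whole automaton over to
  \<open>S\<close>. The map \<open>g\<close> then commutes with transitions, so by induction on the
  word the vector automaton reaches \<open>g\<close> of the state that \<open>\<D>\<close> reaches;
  the terminal weight \<open>weight \<D> \<circ> f\<close> undoes \<open>g\<close>. Since
  \<open>f (g a) = a\<close> is available only for states \<open>a\<close>,
  \<open>foldl_closed\<close> serves to keep runs inside the state set.\<close>

lemma foldl_closed:
  assumes "a \<in> A" and "\<And>b x. b \<in> A \<Longrightarrow> x \<in> X \<Longrightarrow> t b x \<in> A" and "u \<in> lists X"
  shows "foldl t a u \<in> A"
  using assms(3,1) by (induction u arbitrary: a) (auto intro: assms(2))

theorem theorem4p1:
  fixes X :: "'x set"
    and \<D> :: "('d, 'x) crisp_automaton"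
    and S :: "'v::real_vector set"
  assumes "crisp_det_weighted_automaton X \<D>"
    and "S \<approx> states \<D>"
  shows "\<exists>\<A> :: ('v, 'x) vector_automaton.
           weighted_automaton_over X \<A> \<and> vstates \<A> = S \<and>
           (\<forall>u\<in>lists X. vbehavior \<A> u = behavior \<D> u)"
proof -
  from assms(2) obtain f where f: "bij_betw f S (states \<D>)"
    by (auto simp: eqpoll_def)
  define g where "g = inv_into S f"
  have g: "g a \<in> S" and fg: "f (g a) = a" if "a \<in> states \<D>" for a
    using f that unfolding g_def bij_betw_def by (auto intro: inv_into_into f_inv_into_f)
  have fS: "f \<alpha> \<in> states \<D>" if "\<alpha> \<in> S" for \<alpha>
    using f that by (auto simp: bij_betw_def)
  have init: "init \<D> \<in> states \<D>"
    and closed: "\<And>a x. a \<in> states \<D> \<Longrightarrow> x \<in> X \<Longrightarrow> trans \<D> a x \<in> states \<D>"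
    using assms(1) by (auto simp: crisp_det_weighted_automaton_def)
  \<comment> \<open>Each transition is conjugated by the bijection: decode the vector with
    \<open>f\<close>, move in \<open>\<D>\<close>, encode the result with \<open>g\<close>.\<close>
  define \<A> where "\<A> = \<lparr>vstates = S, vinit = g (init \<D>),
    vtrans = (\<lambda>\<alpha> x. g (trans \<D> (f \<alpha>) x)), vweight = weight \<D> \<circ> f\<rparr>"
  have "weighted_automaton_over X \<A>"
    using g init closed fS by (auto simp: weighted_automaton_over_def \<A>_def)
  moreover have "vbehavior \<A> u = behavior \<D> u" if "u \<in> lists X" for u
  proof -
    have "vtrans_ext \<A> (vinit \<A>) u = g (trans_ext \<D> (init \<D>) u)"
      using that
    proof (induction u rule: rev_induct)
      case Nil
      then show ?case by (simp add: trans_ext_Nil vtrans_ext_Nil \<A>_def)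
    next
      case (snoc x u)
      \<comment> \<open>The next transition applies \<open>f\<close> to \<open>g\<close> of the
        state reached so far; the two cancel because that state belongs to
        \<open>states \<D>\<close>.\<close>
      then have "trans_ext \<D> (init \<D>) u \<in> states \<D>"
        unfolding trans_ext_def by (auto intro: foldl_closed init closed)
      with snoc show ?case
        by (simp add: trans_ext_snoc vtrans_ext_snoc) (simp add: \<A>_def fg)
    qed
    \<comment> \<open>Membership of the final state allows the same cancellation inside the terminal
      weight.\<close>
    moreover have "trans_ext \<D> (init \<D>) u \<in> states \<D>"
      unfolding trans_ext_def using that by (auto intro: foldl_closed init closed)
    ultimately show ?thesis
      by (simp add: vbehavior_def behavior_def \<A>_def fg)
  qed
  ultimately show ?thesis
    by (intro exI[of _ \<A>]) (simp add: \<A>_def)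
qed

end
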